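(* Every finite automaton $(X,f)$, regarded as a dynamical system, has chaotic limits.
   Context: A dynamical system $(X,f)$ is a continuous map $f:X\to X$ of a compact metric space $X$ to itself. A point $x$ is periodic if $f^n(x)=x$ for some $n>0$. The $\omega$-limit set of $A\subseteq X$ is $\omega(A)=\bigcap_{n}\overline{\bigcup_{m>n} f^m(A)}$; for nonempty $A$ it is nonempty, closed and invariant, so $(\omega(A),f)$ is a dynamical system. A dynamical system $(X,f)$ is chaotic if its periodic points are dense in $X$ and for any nonempty open sets $U,V\subseteq X$ there is $k>0$ with $f^k(U)\cap V\neq\emptyset$ (finite systems are allowed). The system $(X,f)$ has chaotic limits if for each $x\in X$ there exists $A\subseteq X$ such that $x\in A$ and $(\omega(A),f)$ is chaotic. Finite automata. For a finite alphabet $A$ let $A^{\mathbb N}$ be the set of infinite sequences $u=u_0u_1u_2\ldots$ with $u_i\in A$ and metric $2^{-n}$, $n=\inf\{i\ge 0: u_i\ne v_i\}$. Let $\bullet,\sharp$ be symbols not in the alphabets, and define on $A^{\mathbb N}$: $\sigma_\sharp(u_0u_1u_2\ldots)=u_1u_2u_3\ldots$, $\sigma_\bullet(u)=u$, and $\sigma_a(u_0u_1\ldots)=au_0u_1\ldots$ for $a\in A$. Let $T$ be a finite set (of tapes) and for each $t\in T$ let $A_t$ be a finite alphabet. Put $Q=\prod_{t\in T}A_t$, $X=\prod_{t\in T}A_t^{\mathbb N}$ with a product metric, and $\pi:X\to Q$, $\pi(u)_t=u_{t0}$. The automaton with transition functions $f_t:Q\to A_t\cup\{\bullet,\sharp\}$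 $(t\in T)$ is the dynamical system $(X,f)$ with $f(u)_t=\sigma_{f_t(\pi(u))}(u_t)$ for $u\in X$, $t\in T$. A tape $t$ is an input tape if $f_t(q)\in\{\bullet,\sharp\}$ for all $q\in Q$, and an output tape if $f_t(q)\in A_t\cup\{\bullet\}$ for all $q\in Q$. The automaton is a finite automaton if every tape is an input tape or an output tape. *)

theory Defs
  imports "HOL-Analysis.Analysis"
begin

section \<open>Dynamical systems on metric spaces\<close>

definition dynamical_system :: "'a metric \<Rightarrow> ('a \<Rightarrow> 'a) \<Rightarrow> bool" where
  "dynamical_system M f \<longleftrightarrow>
     compact_space (mtopology_of M) \<and> continuous_map (mtopology_of M) (mtopology_of M) f"

definition periodic_point :: "('a \<Rightarrow> 'a) \<Rightarrow> 'a \<Rightarrow> bool" where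
  "periodic_point f x \<longleftrightarrow> (\<exists>n>0. (f ^^ n) x = x)"

definition omega_limit :: "'a metric \<Rightarrow> ('a \<Rightarrow> 'a) \<Rightarrow> 'a set \<Rightarrow> 'a set" where
  "omega_limit M f A = (\<Inter>n. mtopology_of M closure_of (\<Union>m\<in>{n<..}. (f ^^ m) ` A))"

definition chaotic :: "'a metric \<Rightarrow> ('a \<Rightarrow> 'a) \<Rightarrow> bool" where
  "chaotic M f \<longleftrightarrow>
     dynamical_system M f \<and>
     mtopology_of M closure_of {x \<in> mspace M. periodic_point f x} = mspace M \<and>
     (\<forall>U V. openin (mtopology_of M) U \<and> openin (mtopology_of M) V \<and> U \<noteq> {} \<and> V \<noteq> {} \<longrightarrow>
        (\<exists>k>0. (f ^^ k) ` U \<inter> V \<noteq> {}))"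

definition has_chaotic_limits :: "'a metric \<Rightarrow> ('a \<Rightarrow> 'a) \<Rightarrow> bool" where
  "has_chaotic_limits M f \<longleftrightarrow>
     dynamical_system M f \<and>
     (\<forall>x \<in> mspace M. \<exists>A \<subseteq> mspace M. x \<in> A \<and> chaotic (submetric M (omega_limit M f A)) f)"


section \<open>Automata\<close>

text \<open>Transition values: \<open>Stay\<close> is the symbol bullet, \<open>Shift\<close> the symbol sharp, and
  \<open>Push a\<close> a letter of the alphabet, so that the first two never occur in an alphabet.\<close>

datatype 'a move = Stay | Shift | Push 'a

primrec move_tape :: "'a move \<Rightarrow> (nat \<Rightarrow> 'a) \<Rightarrow> (nat \<Rightarrow> 'a)" where
  "move_tape Stay u = u"
| "move_tape Shift u = (\<lambda>i. u (Suc i))"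
| "move_tape (Push a) u = case_nat a u"

text \<open>The alphabets are subsets of one type \<open>'a\<close>; elements of the two products below are
  extensional functions, i.e. \<open>undefined\<close> outside the set \<open>T\<close> of tapes.\<close>

definition states :: "'t set \<Rightarrow> ('t \<Rightarrow> 'a set) \<Rightarrow> ('t \<Rightarrow> 'a) set" where
  "states T A = (\<Pi>\<^sub>E t\<in>T. A t)"

definition configs :: "'t set \<Rightarrow> ('t \<Rightarrow> 'a set) \<Rightarrow> ('t \<Rightarrow> nat \<Rightarrow> 'a) set" where
  "configs T A = (\<Pi>\<^sub>E t\<in>T. UNIV \<rightarrow> A t)"

definition heads :: "'t set \<Rightarrow> ('t \<Rightarrow> nat \<Rightarrow> 'a) \<Rightarrow> ('t \<Rightarrow> 'a)" where
  "heads T u = (\<lambda>t\<in>T. u t 0)"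

definition seq_dist :: "(nat \<Rightarrow> 'a) \<Rightarrow> (nat \<Rightarrow> 'a) \<Rightarrow> real" where
  "seq_dist u v = (if u = v then 0 else (1/2) ^ (LEAST i. u i \<noteq> v i))"

text \<open>Of the equivalent product metrics we take the sum metric.\<close>

definition config_dist :: "'t set \<Rightarrow> ('t \<Rightarrow> nat \<Rightarrow> 'a) \<Rightarrow> ('t \<Rightarrow> nat \<Rightarrow> 'a) \<Rightarrow> real" where
  "config_dist T u v = (\<Sum>t\<in>T. seq_dist (u t) (v t))"

definition config_metric :: "'t set \<Rightarrow> ('t \<Rightarrow> 'a set) \<Rightarrow> ('t \<Rightarrow> nat \<Rightarrow> 'a) metric" where
  "config_metric T A = metric (configs T A, config_dist T)"

definition automaton_map ::
  "'t set \<Rightarrow> ('t \<Rightarrow> ('t \<Rightarrow> 'a) \<Rightarrow> 'a move) \<Rightarrow> ('t \<Rightarrow> nat \<Rightarrow> 'a) \<Rightarrow> ('t \<Rightarrow> nat \<Rightarrow> 'a)" where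
  "automaton_map T \<delta> u = (\<lambda>t\<in>T. move_tape (\<delta> t (heads T u)) (u t))"

definition automaton ::
  "'t set \<Rightarrow> ('t \<Rightarrow> 'a set) \<Rightarrow> ('t \<Rightarrow> ('t \<Rightarrow> 'a) \<Rightarrow> 'a move) \<Rightarrow> bool" where
  "automaton T A \<delta> \<longleftrightarrow>
     finite T \<and> (\<forall>t\<in>T. finite (A t)) \<and>
     (\<forall>t\<in>T. \<delta> t \<in> states T A \<rightarrow> Push ` A t \<union> {Stay, Shift})"

definition input_tape ::
  "'t set \<Rightarrow> ('t \<Rightarrow> 'a set) \<Rightarrow> ('t \<Rightarrow> ('t \<Rightarrow> 'a) \<Rightarrow> 'a move) \<Rightarrow> 't \<Rightarrow> bool" where
  "input_tape T A \<delta> t \<longleftrightarrow> (\<forall>q \<in> states T A. \<delta> t q \<in> {Stay, Shift})"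

definition output_tape ::
  "'t set \<Rightarrow> ('t \<Rightarrow> 'a set) \<Rightarrow> ('t \<Rightarrow> ('t \<Rightarrow> 'a) \<Rightarrow> 'a move) \<Rightarrow> 't \<Rightarrow> bool" where
  "output_tape T A \<delta> t \<longleftrightarrow> (\<forall>q \<in> states T A. \<delta> t q \<in> Push ` A t \<union> {Stay})"

definition finite_automaton ::
  "'t set \<Rightarrow> ('t \<Rightarrow> 'a set) \<Rightarrow> ('t \<Rightarrow> ('t \<Rightarrow> 'a) \<Rightarrow> 'a move) \<Rightarrow> bool" where
  "finite_automaton T A \<delta> \<longleftrightarrow>
     automaton T A \<delta> \<and> (\<forall>t\<in>T. input_tape T A \<delta> t \<or> output_tape T A \<delta> t)"


section \<open>The metric on configurations is well defined\<close>

lemma seq_dist_le_iff: "seq_dist u v \<le> (1/2) ^ n \<longleftrightarrow> (\<forall>i<n. u i = v i)"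
proof (cases "u = v")
  case True
  then show ?thesis by (simp add: seq_dist_def)
next
  case False
  define k where "k = (LEAST i. u i \<noteq> v i)"
  have "\<exists>i. u i \<noteq> v i"
    using False by blast
  then have k1: "u k \<noteq> v k"
    unfolding k_def by (rule LeastI_ex)
  have k2: "u i = v i" if "i < k" for i
    using not_less_Least[OF that[unfolded k_def]] by blast
  have "seq_dist u v = (1/2) ^ k"
    using False by (simp only: seq_dist_def k_def if_False)
  moreover have "((1/2::real) ^ k \<le> (1/2) ^ n) \<longleftrightarrow> n \<le> k"
    by (rule power_decreasing_iff) simp_all
  ultimately have "seq_dist u v \<le> (1/2) ^ n \<longleftrightarrow> n \<le> k"
    by (simp only:)
  also have "\<dots> \<longleftrightarrow> (\<forall>i<n. u i = v i)"
  proof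
    assume "n \<le> k"
    then show "\<forall>i<n. u i = v i" using k2 by simp
  next
    assume "\<forall>i<n. u i = v i"
    then show "n \<le> k" using k1 not_le by blast
  qed
  finally show ?thesis .
qed

lemma seq_dist_nonneg: "0 \<le> seq_dist u v"
  by (simp add: seq_dist_def)

lemma seq_dist_commute: "seq_dist u v = seq_dist v u"
proof -
  have "(\<lambda>i. u i \<noteq> v i) = (\<lambda>i. v i \<noteq> u i)" by auto
  then show ?thesis by (auto simp: seq_dist_def)
qed

lemma seq_dist_eq_0_iff: "seq_dist u v = 0 \<longleftrightarrow> u = v"
  by (simp add: seq_dist_def)

lemma seq_dist_ultra: "seq_dist u w \<le> max (seq_dist u v) (seq_dist v w)"
proof (cases "u = v \<or> v = w")
  case True
  then show ?thesis by (auto simp: seq_dist_nonneg)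
next
  case False
  then obtain a b where a: "seq_dist u v = (1/2) ^ a" and b: "seq_dist v w = (1/2) ^ b"
    by (auto simp: seq_dist_def)
  have "\<forall>i<min a b. u i = w i"
    using seq_dist_le_iff[of u v a, unfolded a] seq_dist_le_iff[of v w b, unfolded b] by auto
  then have "seq_dist u w \<le> (1/2) ^ min a b"
    by (simp only: seq_dist_le_iff)
  also have "\<dots> \<le> max ((1/2) ^ a) ((1/2) ^ b)"
    by (cases "a \<le> b") (simp_all only: min.absorb1 min.absorb2 max.cobounded1 max.cobounded2 nat_le_linear)
  finally show ?thesis by (simp only: a b)
qed

lemma Metric_space_config:
  fixes T :: "'t set" and A :: "'t \<Rightarrow> 'a set"
  assumes "finite T"
  shows "Metric_space (configs T A) (config_dist T)"
proof
  show "0 \<le> config_dist T u v" for u v :: "'t \<Rightarrow> nat \<Rightarrow> 'a"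
    by (simp add: config_dist_def sum_nonneg seq_dist_nonneg)
  show "config_dist T u v = config_dist T v u" for u v :: "'t \<Rightarrow> nat \<Rightarrow> 'a"
    unfolding config_dist_def by (intro sum.cong refl seq_dist_commute)
  show "config_dist T u v = 0 \<longleftrightarrow> u = v" if "u \<in> configs T A" "v \<in> configs T A"
    for u v :: "'t \<Rightarrow> nat \<Rightarrow> 'a"
  proof -
    have "config_dist T u v = 0 \<longleftrightarrow> (\<forall>t\<in>T. u t = v t)"
      using assms by (simp add: config_dist_def sum_nonneg_eq_0_iff seq_dist_nonneg
          seq_dist_eq_0_iff)
    moreover have "(\<forall>t\<in>T. u t = v t) \<longleftrightarrow> u = v"
      using that unfolding configs_def by (metis PiE_ext)
    ultimately show ?thesis
      by (simp only:)
  qed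
  show "config_dist T u w \<le> config_dist T u v + config_dist T v w"
    for u v w :: "'t \<Rightarrow> nat \<Rightarrow> 'a"
  proof -
    have "seq_dist (u t) (w t) \<le> seq_dist (u t) (v t) + seq_dist (v t) (w t)" for t
      using seq_dist_ultra[of "u t" "w t" "v t"] seq_dist_nonneg[of "u t" "v t"]
        seq_dist_nonneg[of "v t" "w t"] by linarith
    then show ?thesis
      unfolding config_dist_def sum.distrib[symmetric] by (rule sum_mono)
  qed
qed

lemma mspace_config_metric: "finite T \<Longrightarrow> mspace (config_metric T A) = configs T A"
  and mdist_config_metric: "finite T \<Longrightarrow> mdist (config_metric T A) = config_dist T"
  by (simp_all add: config_metric_def Metric_space_config Metric_space.mspace_metric Metric_space.mdist_metric)

end

theory Submission
  imports Defs "HOL-Library.Omega_Words_Fun"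
begin

text \<open>Starting from \<open>x\<close>, some state \<open>q\<close> recurs infinitely often; let \<open>S\<close> be the set of tapes that
  move infinitely often, and let \<open>c\<close> be a point of the orbit in state \<open>q\<close> after which the other
  tapes never move. A run from \<open>q\<close> to \<open>q\<close> that moves exactly the tapes of \<open>S\<close> only depends on the
  words it reads, and it determines a periodic point: repeat the words read (on the input tapes) and
  the words written (on the output tapes) forever, and copy the other tapes from \<open>c\<close>. Let \<open>P\<close> be the
  set of the orbits of these points. Such runs can be concatenated, which makes the closure of \<open>P\<close>
  transitive. The orbit of \<open>x\<close> gets arbitrarily close to \<open>P\<close>: around a late time there is a long
  piece of the orbit from \<open>q\<close> to \<open>q\<close>, whose periodic point has the same recent past and near future.
  Hence the limit set of \<open>{x} \<union> P\<close> is the closure of \<open>P\<close>.\<close>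

section \<open>The topology of configuration spaces\<close>

text \<open>Cylinders replace balls: they form a neighbourhood base of the sum metric, so all
  topology below reduces to comparing finite prefixes.\<close>

definition cylinder :: "'t set \<Rightarrow> ('t \<Rightarrow> 'a set) \<Rightarrow> nat \<Rightarrow> ('t \<Rightarrow> nat \<Rightarrow> 'a) \<Rightarrow> ('t \<Rightarrow> nat \<Rightarrow> 'a) set" where
  "cylinder T A n u = {v \<in> configs T A. \<forall>t\<in>T. \<forall>i<n. v t i = u t i}"

lemma cylinder_subset: "cylinder T A n u \<subseteq> configs T A"
  by (auto simp: cylinder_def)

lemma cylinder_mono: "m \<le> n \<Longrightarrow> cylinder T A n u \<subseteq> cylinder T A m u"
  by (auto simp: cylinder_def)

text \<open>As in any ultrametric space, every point of a cylinder is a centre of it.\<close>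

lemma cylinder_eq: "v \<in> cylinder T A n u \<Longrightarrow> cylinder T A n v = cylinder T A n u"
  by (auto simp: cylinder_def)

text \<open>Agreement on \<open>n\<close> letters bounds each of the \<open>card T\<close> summands
  by \<open>(1/2) ^ n\<close>. The \<open>+ 1\<close> in the denominator covers empty
  \<open>T\<close> and makes the final inequality strict.\<close>

lemma cylinder_subset_ball:
  assumes "finite T" "e > 0"
  shows "\<exists>n. \<forall>v\<in>cylinder T A n u. config_dist T u v < e"
proof -
  have pos: "0 < e / (card T + 1)"
    using assms by simp
  have "\<exists>n. (1/2::real) ^ n < e / (card T + 1)"
    by (rule real_arch_pow_inv[OF pos]) simp
  then obtain n where n: "(1/2::real) ^ n < e / (card T + 1)" ..
  have "config_dist T u v < e" if "v \<in> cylinder T A n u" for v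
  proof -
    have "seq_dist (u t) (v t) \<le> (1/2) ^ n" if "t \<in> T" for t
      using \<open>v \<in> _\<close> that unfolding seq_dist_le_iff cylinder_def by auto
    then have "config_dist T u v \<le> card T * (1/2) ^ n"
      unfolding config_dist_def
      using sum_bounded_above[of T "\<lambda>t. seq_dist (u t) (v t)" "(1/2) ^ n"] by simp
    also have "\<dots> \<le> card T * (e / (card T + 1))"
      using n by (intro mult_left_mono) auto
    also have "\<dots> < e"
      using \<open>e > 0\<close> by (simp add: field_simps)
    finally show ?thesis .
  qed
  then show ?thesis by blast
qed

lemma ball_subset_cylinder:
  assumes "finite T" "v \<in> configs T A" "config_dist T u v < (1/2) ^ n"
  shows "v \<in> cylinder T A n u"
proof -
  have "u t i = v t i" if "t \<in> T" "i < n" for t i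
  proof -
    have "seq_dist (u t) (v t) \<le> config_dist T u v"
      unfolding config_dist_def using assms(1) \<open>t \<in> T\<close>
      by (intro member_le_sum) (auto simp: seq_dist_nonneg)
    then have "seq_dist (u t) (v t) \<le> (1/2) ^ n"
      using assms(3) by linarith
    then show ?thesis
      using \<open>i < n\<close> unfolding seq_dist_le_iff by blast
  qed
  then show ?thesis
    using assms(2) by (auto simp: cylinder_def)
qed

lemma openin_config:
  assumes "finite T"
  shows "openin (mtopology_of (config_metric T A)) U \<longleftrightarrow>
    U \<subseteq> configs T A \<and> (\<forall>u\<in>U. \<exists>n. cylinder T A n u \<subseteq> U)"
proof -
  interpret Metric_space "configs T A" "config_dist T"
    using assms by (rule Metric_space_config)
  have top: "mtopology_of (config_metric T A) = mtopology"
    using assms by (simp add: mtopology_of_def mspace_config_metric mdist_config_metric)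
  have "(\<exists>r>0. mball u r \<subseteq> U) \<longleftrightarrow> (\<exists>n. cylinder T A n u \<subseteq> U)" if "u \<in> configs T A" for u
  proof
    assume "\<exists>r>0. mball u r \<subseteq> U"
    then obtain r where r: "r > 0" "mball u r \<subseteq> U" by blast
    obtain n where "\<forall>v\<in>cylinder T A n u. config_dist T u v < r"
      using cylinder_subset_ball[OF assms r(1)] by blast
    then have "cylinder T A n u \<subseteq> mball u r"
      using that by (auto simp: cylinder_def)
    then show "\<exists>n. cylinder T A n u \<subseteq> U" using r by blast
  next
    assume "\<exists>n. cylinder T A n u \<subseteq> U"
    then obtain n where n: "cylinder T A n u \<subseteq> U" by blast
    have "mball u ((1/2) ^ n) \<subseteq> cylinder T A n u"
      using ball_subset_cylinder[OF assms] by auto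
    with n show "\<exists>r>0. mball u r \<subseteq> U"
      by (intro exI[of _ "(1/2) ^ n"]) auto
  qed
  then show ?thesis
    unfolding top openin_mtopology by (meson subsetD)
qed

lemma topspace_config:
  "finite T \<Longrightarrow> topspace (mtopology_of (config_metric T A)) = configs T A"
  by (simp add: mspace_config_metric)

lemma openin_cylinder:
  "finite T \<Longrightarrow> openin (mtopology_of (config_metric T A)) (cylinder T A n u)"
  unfolding openin_config using cylinder_subset cylinder_eq by (metis order_refl)

lemma closure_of_config:
  assumes "finite T"
  shows "mtopology_of (config_metric T A) closure_of S =
    {u \<in> configs T A. \<forall>n. \<exists>v\<in>S. v \<in> cylinder T A n u}"
proof -
  have "(\<forall>U. u \<in> U \<and> openin (mtopology_of (config_metric T A)) U \<longrightarrow> (\<exists>v\<in>S. v \<in> U))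
      \<longleftrightarrow> (\<forall>n. \<exists>v\<in>S. v \<in> cylinder T A n u)" if "u \<in> configs T A" for u
  proof (intro iffI allI impI)
    fix n
    assume "\<forall>U. u \<in> U \<and> openin (mtopology_of (config_metric T A)) U \<longrightarrow> (\<exists>v\<in>S. v \<in> U)"
    moreover have "u \<in> cylinder T A n u"
      using that by (simp add: cylinder_def)
    ultimately show "\<exists>v\<in>S. v \<in> cylinder T A n u"
      using openin_cylinder[OF assms] by blast
  next
    fix U
    assume "\<forall>n. \<exists>v\<in>S. v \<in> cylinder T A n u"
      and "u \<in> U \<and> openin (mtopology_of (config_metric T A)) U"
    then show "\<exists>v\<in>S. v \<in> U"
      unfolding openin_config[OF assms] by (metis subsetD)
  qed
  then show ?thesis
    unfolding closure_of_def topspace_config[OF assms] by (simp cong: conj_cong)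
qed

text \<open>Tychonoff's theorem makes the product of the finite discrete alphabets compact. It then
  suffices that the identity from the product topology to the metric topology is continuous, since
  compactness passes to images.\<close>

lemma compact_space_config:
  assumes "finite T" "\<forall>t\<in>T. finite (A t)"
  shows "compact_space (mtopology_of (config_metric T A))"
proof -
  define Y where "Y = (\<lambda>t. product_topology (\<lambda>_::nat. discrete_topology (A t)) UNIV)"
  have top: "topspace (product_topology Y T) = configs T A"
    by (auto simp: Y_def configs_def PiE_UNIV_domain)
  have comp: "compact_space (product_topology Y T)"
    using assms by (auto simp: Y_def compact_space_product_topology compact_space_discrete_topology)
  have op: "openin (product_topology Y T) (cylinder T A n u)" for n u
  proof -
    have "openin (product_topology Y T)
        {v \<in> topspace (product_topology Y T). v t i \<in> {u t i} \<inter> A t}" if "t \<in> T" for t i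
    proof (rule openin_continuous_map_preimage)
      have "continuous_map (product_topology Y T) (Y t) (\<lambda>v. v t)"
        using that by (rule continuous_map_product_projection)
      moreover have "continuous_map (Y t) (discrete_topology (A t)) (\<lambda>s. s i)"
        unfolding Y_def by (rule continuous_map_product_projection) simp
      ultimately show "continuous_map (product_topology Y T) (discrete_topology (A t)) (\<lambda>v. v t i)"
        by (auto dest: continuous_map_compose simp: o_def)
    qed simp
    note slice = this
    show ?thesis
    \<comment> \<open>A finite intersection of open sets is known to be open only for a nonempty
      family, so the cylinder without constraints is treated apart.\<close>
    proof (cases "T \<times> {..<n} = {}")
      case True
      then have "cylinder T A n u = topspace (product_topology Y T)"
        unfolding top cylinder_def by auto
      then show ?thesis by (simp only: openin_topspace)
    next
      case False
      have "openin (product_topology Y T) (\<Inter>p\<in>T \<times> {..<n}.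
          {v \<in> topspace (product_topology Y T). v (fst p) (snd p) \<in> {u (fst p) (snd p)} \<inter> A (fst p)})"
        using assms(1) False by (intro openin_INT2 slice) auto
      moreover have "(\<Inter>p\<in>T \<times> {..<n}.
          {v \<in> topspace (product_topology Y T). v (fst p) (snd p) \<in> {u (fst p) (snd p)} \<inter> A (fst p)})
          = cylinder T A n u"
      proof -
        have "v \<in> cylinder T A n u" if "v \<in> configs T A" "\<And>t i. t \<in> T \<Longrightarrow> i < n \<Longrightarrow> v t i = u t i" for v
          using that by (simp add: cylinder_def)
        moreover have "v t i \<in> A t" if "v \<in> configs T A" "t \<in> T" for v t i
          using that by (auto simp: configs_def)
        ultimately show ?thesis
          using False unfolding top by (auto simp: cylinder_def)
      qed
      ultimately show ?thesis by (simp only:)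
    qed
  qed
  have "continuous_map (product_topology Y T) (mtopology_of (config_metric T A)) (\<lambda>u. u)"
    unfolding continuous_map_def
  proof (intro conjI allI impI)
    show "(\<lambda>u. u) \<in> topspace (product_topology Y T) \<rightarrow> topspace (mtopology_of (config_metric T A))"
      unfolding top topspace_config[OF assms(1)] by blast
    fix U
    assume "openin (mtopology_of (config_metric T A)) U"
    then have U: "U \<subseteq> configs T A" "\<forall>u\<in>U. \<exists>n. cylinder T A n u \<subseteq> U"
      unfolding openin_config[OF assms(1)] by auto
    have "openin (product_topology Y T) U"
    proof (subst openin_subopen, intro ballI)
      fix u
      assume u: "u \<in> U"
      then obtain n where "cylinder T A n u \<subseteq> U" using U by blast
      moreover have "u \<in> cylinder T A n u"
        using U u by (auto simp: cylinder_def)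
      ultimately show "\<exists>V. openin (product_topology Y T) V \<and> u \<in> V \<and> V \<subseteq> U"
        using op by blast
    qed
    moreover have "{u \<in> topspace (product_topology Y T). u \<in> U} = U"
      unfolding top using U by blast
    ultimately show "openin (product_topology Y T) {u \<in> topspace (product_topology Y T). u \<in> U}"
      by simp
  qed
  then have "compactin (mtopology_of (config_metric T A)) ((\<lambda>u. u) ` configs T A)"
    using comp unfolding compact_space_def top by (rule image_compactin[rotated])
  then show ?thesis
    unfolding compact_space_def topspace_config[OF assms(1)] by simp
qed

section \<open>Runs of a finite automaton\<close>

definition prepend :: "'t set \<Rightarrow> ('t \<Rightarrow> 'a list) \<Rightarrow> ('t \<Rightarrow> nat \<Rightarrow> 'a) \<Rightarrow> ('t \<Rightarrow> nat \<Rightarrow> 'a)" where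
  "prepend T \<alpha> v = (\<lambda>t\<in>T. \<alpha> t \<frown> v t)"

lemma prepend_apply: "t \<in> T \<Longrightarrow> prepend T \<alpha> v t = \<alpha> t \<frown> v t"
  by (simp add: prepend_def)

lemma prepend_prepend: "prepend T \<alpha> (prepend T \<beta> v) = prepend T (\<lambda>t. \<alpha> t @ \<beta> t) v"
  by (auto simp: prepend_def fun_eq_iff)

lemma prepend_empty: "v \<in> configs T A \<Longrightarrow> prepend T (\<lambda>_. []) v = v"
  by (auto simp: prepend_def configs_def fun_eq_iff PiE_def extensional_def)

text \<open>The expression \<open>hd (w @ [a])\<close> denotes the first letter of \<open>w\<close>,
  or \<open>a\<close> if \<open>w\<close> is empty. The head conditions in \<open>transit\<close>
  have this form, which spares a case distinction there.\<close>

lemma conc_0: "(w \<frown> s) 0 = hd (w @ [s 0])"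
  by (cases w) (auto simp: conc_def)

locale finite_automaton_system =
  fixes T :: "'t set" and A :: "'t \<Rightarrow> 'a set" and \<delta> :: "'t \<Rightarrow> ('t \<Rightarrow> 'a) \<Rightarrow> 'a move"
  assumes finite_automaton: "finite_automaton T A \<delta>"
begin

abbreviation f where "f \<equiv> automaton_map T \<delta>"
abbreviation X where "X \<equiv> configs T A"
abbreviation top where "top \<equiv> mtopology_of (config_metric T A)"

text \<open>A tape that is both an input and an output tape, that is, one that always stays, counts
  as an input tape. All tapes outside \<open>inputs\<close> are output tapes.\<close>

definition inputs :: "'t set" where
  "inputs = {t \<in> T. input_tape T A \<delta> t}"

lemma finite_tapes [simp]: "finite T"
  using finite_automaton by (simp add: finite_automaton_def automaton_def)

lemma finite_alphabet: "t \<in> T \<Longrightarrow> finite (A t)"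
  using finite_automaton by (simp add: finite_automaton_def automaton_def)

lemma finite_states: "finite (states T A)"
  unfolding states_def using finite_alphabet by (intro finite_PiE) auto

lemma transition: "t \<in> T \<Longrightarrow> q \<in> states T A \<Longrightarrow> \<delta> t q \<in> Push ` A t \<union> {Stay, Shift}"
  using finite_automaton by (fastforce simp: finite_automaton_def automaton_def)

lemma input_transition: "t \<in> inputs \<Longrightarrow> q \<in> states T A \<Longrightarrow> \<delta> t q \<in> {Stay, Shift}"
  by (simp add: inputs_def input_tape_def)

lemma output_transition:
  "t \<in> T \<Longrightarrow> t \<notin> inputs \<Longrightarrow> q \<in> states T A \<Longrightarrow> \<delta> t q \<in> Push ` A t \<union> {Stay}"
  using finite_automaton by (fastforce simp: finite_automaton_def inputs_def output_tape_def)

lemma heads_in: "u \<in> X \<Longrightarrow> heads T u \<in> states T A"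
  by (auto simp: heads_def states_def configs_def)

lemma configs_iff: "u \<in> X \<longleftrightarrow> (\<forall>t\<in>T. \<forall>i. u t i \<in> A t) \<and> u \<in> extensional T"
  by (auto simp: configs_def PiE_def Pi_def)

section \<open>The automaton map as a continuous self-map\<close>

lemma f_apply: "t \<in> T \<Longrightarrow> f u t = move_tape (\<delta> t (heads T u)) (u t)"
  by (simp add: automaton_map_def)

lemma f_in:
  assumes u: "u \<in> X"
  shows "f u \<in> X"
proof -
  have "f u t i \<in> A t" if t: "t \<in> T" for t i
    using transition[OF t heads_in[OF u]] u t
    by (auto simp: f_apply configs_iff split: nat.split)
  then show ?thesis
    by (auto simp: configs_iff automaton_map_def)
qed

lemma funpow_f_in: "u \<in> X \<Longrightarrow> (f ^^ n) u \<in> X"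
  by (induction n) (auto simp: f_in)

text \<open>Agreement on at least one letter gives equal states, hence equal moves; a
  \<open>Shift\<close> may then use up one letter of the agreement.\<close>

lemma f_cylinder:
  assumes "u \<in> X" "v \<in> cylinder T A (Suc n) u"
  shows "f v \<in> cylinder T A n (f u)"
proof -
  have v: "v \<in> X" "\<And>t i. t \<in> T \<Longrightarrow> i < Suc n \<Longrightarrow> v t i = u t i"
    using assms(2) by (auto simp: cylinder_def)
  have h: "heads T v = heads T u"
    using v(2) by (auto simp: heads_def fun_eq_iff)
  have "f v t i = f u t i" if "t \<in> T" "i < n" for t i
    using that v(2)
    by (cases "\<delta> t (heads T u)") (auto simp: f_apply h split: nat.split)
  then show ?thesis
    using f_in[OF v(1)] by (auto simp: cylinder_def)
qed

lemma funpow_f_cylinder: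
  "u \<in> X \<Longrightarrow> v \<in> cylinder T A (n + k) u \<Longrightarrow> (f ^^ k) v \<in> cylinder T A n ((f ^^ k) u)"
proof (induction k arbitrary: n)
  case (Suc k)
  then have "(f ^^ k) v \<in> cylinder T A (Suc n) ((f ^^ k) u)"
    by simp
  then show ?case
    using f_cylinder funpow_f_in Suc.prems by simp
qed auto

lemma continuous_f: "continuous_map top top f"
  unfolding continuous_map_def
proof (intro conjI allI impI)
  show "f \<in> topspace top \<rightarrow> topspace top"
    unfolding topspace_config[OF finite_tapes] using f_in by blast
  fix U
  assume "openin top U"
  then have U: "U \<subseteq> X" "\<And>u. u \<in> U \<Longrightarrow> \<exists>n. cylinder T A n u \<subseteq> U"
    unfolding openin_config[OF finite_tapes] by auto
  show "openin top {u \<in> topspace top. f u \<in> U}"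
    unfolding openin_config[OF finite_tapes] topspace_config[OF finite_tapes]
  proof (intro conjI ballI)
    fix u
    assume u: "u \<in> {u \<in> X. f u \<in> U}"
    then obtain n where "cylinder T A n (f u) \<subseteq> U" using U by blast
    then have "cylinder T A (Suc n) u \<subseteq> {u \<in> X. f u \<in> U}"
      using u f_cylinder cylinder_subset[of T A "Suc n" u] by blast
    then show "\<exists>n. cylinder T A n u \<subseteq> {u \<in> X. f u \<in> U}" by blast
  qed blast
qed

lemma dynamical_system_automaton: "dynamical_system (config_metric T A) f"
  unfolding dynamical_system_def
  using compact_space_config[OF finite_tapes] finite_alphabet continuous_f by blast

text \<open>\<open>transit q n \<alpha> \<beta> q'\<close> is a run of length \<open>n\<close> from state \<open>q\<close> to state \<open>q'\<close> that reads the
  words \<open>\<alpha>\<close> off the input tapes and ends with the words \<open>\<beta>\<close> on top of the output tapes,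
  independently of the remaining contents \<open>v\<close>. The first letter of \<open>v\<close> is visible at the end of
  the run on the input tapes, but at its start on the output tapes.\<close>

definition transit ::
  "('t \<Rightarrow> 'a) \<Rightarrow> nat \<Rightarrow> ('t \<Rightarrow> 'a list) \<Rightarrow> ('t \<Rightarrow> 'a list) \<Rightarrow> ('t \<Rightarrow> 'a) \<Rightarrow> bool" where
  "transit q n \<alpha> \<beta> q' \<longleftrightarrow>
     (\<forall>t\<in>T. set (\<alpha> t) \<subseteq> A t \<and> set (\<beta> t) \<subseteq> A t) \<and>
     (\<forall>t\<in>inputs. \<beta> t = [] \<and> hd (\<alpha> t @ [q' t]) = q t) \<and>
     (\<forall>t\<in>T - inputs. \<alpha> t = [] \<and> hd (\<beta> t @ [q t]) = q' t) \<and>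
     (\<forall>v. (\<forall>t\<in>T. v t 0 = (if t \<in> inputs then q' t else q t)) \<longrightarrow>
        (f ^^ n) (prepend T \<alpha> v) = prepend T \<beta> v)"

lemma inputs_subset: "t \<in> inputs \<Longrightarrow> t \<in> T"
  by (simp add: inputs_def)

lemma transit_input: "transit q n \<alpha> \<beta> q' \<Longrightarrow> t \<in> inputs \<Longrightarrow> \<beta> t = []"
  and transit_output: "transit q n \<alpha> \<beta> q' \<Longrightarrow> t \<in> T \<Longrightarrow> t \<notin> inputs \<Longrightarrow> \<alpha> t = []"
  by (auto simp: transit_def)

lemma transit_0: "transit q 0 (\<lambda>_. []) (\<lambda>_. []) q"
  by (auto simp: transit_def)

text \<open>Words read are consumed in order, so the later one goes to the right. Words written are
  stacked, so the later one goes to the left.\<close>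

lemma transit_trans:
  assumes 1: "transit q n \<alpha> \<beta> q'" and 2: "transit q' n' \<alpha>' \<beta>' q''"
  shows "transit q (n + n') (\<lambda>t. \<alpha> t @ \<alpha>' t) (\<lambda>t. \<beta>' t @ \<beta> t) q''"
  unfolding transit_def
proof (intro conjI allI impI)
  show "\<forall>t\<in>T. set (\<alpha> t @ \<alpha>' t) \<subseteq> A t \<and> set (\<beta>' t @ \<beta> t) \<subseteq> A t"
    using assms by (auto simp: transit_def)
  have hd: "hd (xs @ ys @ [z]) = hd (xs @ [hd (ys @ [z])])" for xs ys :: "'a list" and z
    by (cases xs) auto
  show "\<forall>t\<in>inputs. \<beta>' t @ \<beta> t = [] \<and> hd ((\<alpha> t @ \<alpha>' t) @ [q'' t]) = q t"
    "\<forall>t\<in>T - inputs. \<alpha> t @ \<alpha>' t = [] \<and> hd ((\<beta>' t @ \<beta> t) @ [q t]) = q'' t"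
    using assms by (auto simp: transit_def hd)
  fix v :: "'t \<Rightarrow> nat \<Rightarrow> 'a"
  assume v: "\<forall>t\<in>T. v t 0 = (if t \<in> inputs then q'' t else q t)"
  have "\<forall>t\<in>T. prepend T \<alpha>' v t 0 = (if t \<in> inputs then q' t else q t)"
    using v 2 by (auto simp: transit_def prepend_apply conc_0)
  then have a: "(f ^^ n) (prepend T \<alpha> (prepend T \<alpha>' v)) = prepend T \<beta> (prepend T \<alpha>' v)"
    using 1 by (auto simp: transit_def)
  have "\<forall>t\<in>T. prepend T \<beta> v t 0 = (if t \<in> inputs then q'' t else q' t)"
    using v 1 by (auto simp: transit_def prepend_apply conc_0)
  then have b: "(f ^^ n') (prepend T \<alpha>' (prepend T \<beta> v)) = prepend T \<beta>' (prepend T \<beta> v)"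
    using 2 by (auto simp: transit_def)
  \<comment> \<open>The end of the first run has to be recognised as a start of the second. The
    words commute because \<open>\<beta>\<close> is empty on input tapes and
    \<open>\<alpha>'\<close> on output tapes.\<close>
  have "prepend T \<beta> (prepend T \<alpha>' v) = prepend T \<alpha>' (prepend T \<beta> v)"
    unfolding prepend_def
  proof (rule restrict_ext)
    fix t
    assume "t \<in> T"
    then show "\<beta> t \<frown> (\<lambda>t\<in>T. \<alpha>' t \<frown> v t) t = \<alpha>' t \<frown> (\<lambda>t\<in>T. \<beta> t \<frown> v t) t"
      using transit_input[OF 1, of t] transit_output[OF 2, of t] by (cases "t \<in> inputs") auto
  qed
  with a b show "(f ^^ (n + n')) (prepend T (\<lambda>t. \<alpha> t @ \<alpha>' t) v) = prepend T (\<lambda>t. \<beta>' t @ \<beta> t) v"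
    by (simp add: prepend_prepend add.commute[of n] funpow_add)
qed

section \<open>Words read and written along an orbit\<close>

definition read1 :: "('t \<Rightarrow> 'a) \<Rightarrow> 't \<Rightarrow> 'a list" where
  "read1 q t = (if \<delta> t q = Shift then [q t] else [])"

definition write1 :: "('t \<Rightarrow> 'a) \<Rightarrow> 't \<Rightarrow> 'a list" where
  "write1 q t = (case \<delta> t q of Push a \<Rightarrow> [a] | _ \<Rightarrow> [])"

lemma transit_1:
  assumes u: "u \<in> X"
  shows "transit (heads T u) 1 (read1 (heads T u)) (write1 (heads T u)) (heads T (f u))"
proof -
  define q where "q = heads T u"
  have q: "q \<in> states T A" using u by (simp add: q_def heads_in)
  have i: "\<delta> t q \<in> {Stay, Shift}" if "t \<in> inputs" for t
    using input_transition[OF that q] .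
  have o: "\<delta> t q \<in> Push ` A t \<union> {Stay}" if "t \<in> T" "t \<notin> inputs" for t
    using output_transition[OF that q] .
  have qA: "q t \<in> A t" if "t \<in> T" for t
    using q that by (auto simp: states_def)
  have h: "heads T (f u) t = (case \<delta> t q of Push a \<Rightarrow> a | Stay \<Rightarrow> q t | Shift \<Rightarrow> u t 1)"
    if "t \<in> T" for t
    using that by (auto simp: heads_def f_apply q_def split: move.split)
  have "f (prepend T (read1 q) v) = prepend T (write1 q) v"
    if v: "\<forall>t\<in>T. v t 0 = (if t \<in> inputs then heads T (f u) t else q t)" for v
  proof -
    \<comment> \<open>The prepended configuration is in state \<open>q\<close>: after
      \<open>Shift\<close> on an input tape the restored letter is \<open>q t\<close>, after
      \<open>Stay\<close> the letter required of \<open>v\<close> is still \<open>q t\<close>, and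
      on an output tape \<open>v\<close> starts with \<open>q t\<close>.\<close>
    have "(read1 q t \<frown> v t) 0 = q t" if "t \<in> T" for t
      using v that i[of t] o[of t] h[of t]
      by (cases "t \<in> inputs") (auto simp: conc_0 read1_def)
    then have hd: "heads T (prepend T (read1 q) v) = q"
      using q by (auto simp: heads_def prepend_apply fun_eq_iff states_def PiE_def extensional_def)
    have "f (prepend T (read1 q) v) t = prepend T (write1 q) v t" if "t \<in> T" for t
      using that i[of t] o[of t]
      by (cases "t \<in> inputs")
        (auto simp: f_apply hd prepend_apply read1_def write1_def conc_def fun_eq_iff split: nat.split)
    then show ?thesis
      by (auto simp: fun_eq_iff automaton_map_def prepend_def)
  qed
  moreover have "set (read1 q t) \<subseteq> A t \<and> set (write1 q t) \<subseteq> A t" if "t \<in> T" for t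
    using that qA transition[OF that q] by (auto simp: read1_def write1_def)
  moreover have "write1 q t = [] \<and> hd (read1 q t @ [heads T (f u) t]) = q t" if "t \<in> inputs" for t
    using i[OF that] h[OF inputs_subset[OF that]] by (auto simp: read1_def write1_def)
  moreover have "read1 q t = [] \<and> hd (write1 q t @ [q t]) = heads T (f u) t"
    if "t \<in> T" "t \<notin> inputs" for t
    using o[OF that] h[OF that(1)] by (auto simp: read1_def write1_def)
  ultimately show ?thesis
    unfolding q_def[symmetric] by (auto simp: transit_def)
qed

primrec reads :: "('t \<Rightarrow> nat \<Rightarrow> 'a) \<Rightarrow> nat \<Rightarrow> 't \<Rightarrow> 'a list" where
  "reads u 0 = (\<lambda>t. [])"
| "reads u (Suc n) = (\<lambda>t. reads u n t @ read1 (heads T ((f ^^ n) u)) t)"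

primrec writes :: "('t \<Rightarrow> nat \<Rightarrow> 'a) \<Rightarrow> nat \<Rightarrow> 't \<Rightarrow> 'a list" where
  "writes u 0 = (\<lambda>t. [])"
| "writes u (Suc n) = (\<lambda>t. write1 (heads T ((f ^^ n) u)) t @ writes u n t)"

lemma transit_orbit:
  assumes "u \<in> X"
  shows "transit (heads T u) n (reads u n) (writes u n) (heads T ((f ^^ n) u))"
proof (induction n)
  case 0
  then show ?case by (simp add: transit_0)
next
  case (Suc n)
  from transit_trans[OF Suc transit_1[OF funpow_f_in[OF assms]]] show ?case
    by simp
qed

text \<open>Reading loses nothing: the words still to be read form a prefix of the present tape.
  This and its counterpart \<open>output_orbit\<close>, where the words already written form the
  prefix, later allow comparison with loop points.\<close>

lemma input_orbit:
  assumes "u \<in> X" "t \<in> inputs"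
  shows "u t = reads u n t \<frown> (f ^^ n) u t"
proof (induction n)
  case (Suc n)
  have "(f ^^ n) u t = read1 (heads T ((f ^^ n) u)) t \<frown> f ((f ^^ n) u) t"
    using input_transition[OF assms(2) heads_in[OF funpow_f_in[OF assms(1), of n]]]
      inputs_subset[OF assms(2)]
    by (auto simp: f_apply read1_def heads_def conc_def fun_eq_iff)
  with Suc show ?case by simp
qed simp

lemma output_orbit:
  assumes "u \<in> X" "t \<in> T" "t \<notin> inputs"
  shows "(f ^^ n) u t = writes u n t \<frown> u t"
proof (induction n)
  case (Suc n)
  have "f ((f ^^ n) u) t = write1 (heads T ((f ^^ n) u)) t \<frown> (f ^^ n) u t"
    using output_transition[OF assms(2,3) heads_in[OF funpow_f_in[OF assms(1), of n]]]
    by (auto simp: f_apply write1_def assms(2) conc_def fun_eq_iff split: nat.split)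
  with Suc show ?case by simp
qed simp

definition moves :: "('t \<Rightarrow> nat \<Rightarrow> 'a) \<Rightarrow> 't \<Rightarrow> nat set" where
  "moves u t = {k. \<delta> t (heads T ((f ^^ k) u)) \<noteq> Stay}"

text \<open>Every move other than \<open>Stay\<close> reads or writes exactly one letter. Hence a
  tape that moves infinitely often yields arbitrarily long words.\<close>

lemma length_words:
  "length (reads u n t) + length (writes u n t) = card (moves u t \<inter> {..<n})"
proof (induction n)
  case (Suc n)
  have "moves u t \<inter> {..<Suc n} =
      (if n \<in> moves u t then insert n (moves u t \<inter> {..<n}) else moves u t \<inter> {..<n})"
    by (auto simp: less_Suc_eq)
  moreover have "length (read1 (heads T ((f ^^ n) u)) t) + length (write1 (heads T ((f ^^ n) u)) t)
      = (if n \<in> moves u t then 1 else 0)"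
    by (auto simp: moves_def read1_def write1_def split: move.split)
  ultimately show ?case using Suc by (auto split: if_splits)
qed simp

lemma moves_funpow: "moves ((f ^^ m) u) t = {k. k + m \<in> moves u t}"
  by (auto simp: moves_def funpow_add)

section \<open>Periodic points from loops\<close>

text \<open>\<open>S\<close> is the set of the tapes that move along the loop. The contents of the other tapes are
  those of \<open>c\<close>. On every tape at least one of the words \<open>\<alpha>\<close>, \<open>\<beta>\<close> is empty, so that \<open>\<alpha> t @ \<beta> t\<close> is
  just the word read or written.\<close>

definition loop :: "('t \<Rightarrow> 'a) \<Rightarrow> 't set \<Rightarrow> nat \<Rightarrow> ('t \<Rightarrow> 'a list) \<Rightarrow> ('t \<Rightarrow> 'a list) \<Rightarrow> bool" where
  "loop q S n \<alpha> \<beta> \<longleftrightarrow> n > 0 \<and> transit q n \<alpha> \<beta> q \<and> (\<forall>t\<in>T. \<alpha> t @ \<beta> t \<noteq> [] \<longleftrightarrow> t \<in> S)"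

definition loop_point ::
  "('t \<Rightarrow> nat \<Rightarrow> 'a) \<Rightarrow> ('t \<Rightarrow> 'a list) \<Rightarrow> ('t \<Rightarrow> 'a list) \<Rightarrow> ('t \<Rightarrow> nat \<Rightarrow> 'a)" where
  "loop_point c \<alpha> \<beta> = (\<lambda>t\<in>T. if \<alpha> t @ \<beta> t = [] then c t else (\<alpha> t @ \<beta> t)\<^sup>\<omega>)"

definition loop_orbits :: "('t \<Rightarrow> nat \<Rightarrow> 'a) \<Rightarrow> 't set \<Rightarrow> ('t \<Rightarrow> nat \<Rightarrow> 'a) set" where
  "loop_orbits c S =
     {(f ^^ k) (loop_point c \<alpha> \<beta>) | k n \<alpha> \<beta>. loop (heads T c) S n \<alpha> \<beta>}"

lemma loop_trans:
  assumes "loop q S n \<alpha> \<beta>" "loop q S n' \<alpha>' \<beta>'"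
  shows "loop q S (n + n') (\<lambda>t. \<alpha> t @ \<alpha>' t) (\<lambda>t. \<beta>' t @ \<beta> t)"
  using assms transit_trans[of q n \<alpha> \<beta> q n' \<alpha>' \<beta>' q] by (auto simp: loop_def)

lemma loop_point_in:
  assumes "loop q S n \<alpha> \<beta>" "c \<in> X"
  shows "loop_point c \<alpha> \<beta> \<in> X"
proof -
  have "loop_point c \<alpha> \<beta> t i \<in> A t" if t: "t \<in> T" for t i
  proof (cases "\<alpha> t @ \<beta> t = []")
    case True
    then show ?thesis using assms(2) t by (simp add: loop_point_def configs_iff)
  next
    case False
    then have "(\<alpha> t @ \<beta> t)\<^sup>\<omega> i \<in> set (\<alpha> t @ \<beta> t)"
      by (subst iter_nth) (auto simp del: set_append)
    moreover have "set (\<alpha> t @ \<beta> t) \<subseteq> A t"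
      using assms(1) t by (auto simp: loop_def transit_def)
    ultimately show ?thesis using False t by (auto simp: loop_point_def)
  qed
  then show ?thesis by (auto simp: configs_iff loop_point_def)
qed

lemma conc_iter: "w @ w' \<noteq> [] \<Longrightarrow> w = [] \<or> w' = [] \<Longrightarrow>
    w \<frown> (w @ w')\<^sup>\<omega> = (w @ w')\<^sup>\<omega> \<and> w' \<frown> (w @ w')\<^sup>\<omega> = (w @ w')\<^sup>\<omega>"
  using iter_unroll[of w] iter_unroll[of w'] by auto

text \<open>On a moving tape one period is added to a periodic sequence; on every other tape both
  words are empty.\<close>

lemma prepend_loop_point:
  assumes "loop q S n \<alpha> \<beta>"
  shows "prepend T \<alpha> (loop_point c \<alpha> \<beta>) = loop_point c \<alpha> \<beta>"
    and "prepend T \<beta> (loop_point c \<alpha> \<beta>) = loop_point c \<alpha> \<beta>"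
proof -
  have "\<alpha> t = [] \<or> \<beta> t = []" if "t \<in> T" for t
    using assms that transit_input[of q n \<alpha> \<beta> q t] transit_output[of q n \<alpha> \<beta> q t]
    by (auto simp: loop_def)
  then show "prepend T \<alpha> (loop_point c \<alpha> \<beta>) = loop_point c \<alpha> \<beta>"
    "prepend T \<beta> (loop_point c \<alpha> \<beta>) = loop_point c \<alpha> \<beta>"
    unfolding prepend_def loop_point_def by (auto intro!: restrict_ext simp: conc_iter)
qed

text \<open>The first letter read is the one visible at the start, and the last letter written,
  which heads \<open>\<beta> t\<close>, is the one visible at the end. For a loop both are given by
  the state of \<open>c\<close>, so the loop point is in that state.\<close>

lemma heads_loop_point:
  assumes "loop (heads T c) S n \<alpha> \<beta>" "t \<in> T"
  shows "loop_point c \<alpha> \<beta> t 0 = c t 0"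
proof (cases "\<alpha> t @ \<beta> t = []")
  case False
  have "loop_point c \<alpha> \<beta> t 0 = hd (\<alpha> t @ \<beta> t)"
    using False assms(2) by (simp add: loop_point_def iter_def hd_conv_nth del: append_is_Nil_conv)
  also have "\<dots> = c t 0"
  proof (cases "t \<in> inputs")
    case True
    then have "\<beta> t = []" "hd (\<alpha> t @ [c t 0]) = c t 0"
      using assms by (auto simp: loop_def transit_def heads_def)
    then show ?thesis using False by simp
  next
    case notin: False
    then have "\<alpha> t = []" "hd (\<beta> t @ [c t 0]) = c t 0"
      using assms by (auto simp: loop_def transit_def heads_def)
    then show ?thesis using False by simp
  qed
  finally show ?thesis .
qed (use assms in \<open>simp add: loop_point_def\<close>)

text \<open>Unrolling one period of the input tapes exhibits \<open>p\<close> as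
  \<open>\<alpha>\<close> followed by \<open>\<alpha>'\<close> followed by \<open>p\<close>. The
  first run then consumes \<open>\<alpha>\<close> and puts \<open>\<beta>\<close> on top.\<close>

lemma loop_point_transit:
  assumes c: "heads T c = q"
    and 1: "transit q n \<alpha> \<beta> q'" and 2: "transit q' n' \<alpha>' \<beta>' q"
    and l: "loop q S m (\<lambda>t. \<alpha> t @ \<alpha>' t) (\<lambda>t. \<beta>' t @ \<beta> t)"
  defines "p \<equiv> loop_point c (\<lambda>t. \<alpha> t @ \<alpha>' t) (\<lambda>t. \<beta>' t @ \<beta> t)"
  shows "(f ^^ n) p = prepend T \<beta> (prepend T \<alpha>' p)"
proof -
  have p0: "p t 0 = q t" if "t \<in> T" for t
    using heads_loop_point[OF l[folded c] that] that c by (auto simp: p_def heads_def)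
  have "\<forall>t\<in>T. prepend T \<alpha>' p t 0 = (if t \<in> inputs then q' t else q t)"
    using p0 2 by (auto simp: transit_def prepend_apply conc_0)
  then have "(f ^^ n) (prepend T \<alpha> (prepend T \<alpha>' p)) = prepend T \<beta> (prepend T \<alpha>' p)"
    using 1 by (auto simp: transit_def)
  moreover have "prepend T \<alpha> (prepend T \<alpha>' p) = p"
    unfolding prepend_prepend p_def using l by (rule prepend_loop_point)
  ultimately show ?thesis by simp
qed

text \<open>The loop is split into itself and an empty second run; what it leaves on the tapes is
  absorbed by periodicity.\<close>

lemma loop_point_periodic:
  assumes "loop (heads T c) S n \<alpha> \<beta>" "c \<in> X"
  shows "(f ^^ n) (loop_point c \<alpha> \<beta>) = loop_point c \<alpha> \<beta>"
proof -
  have "(f ^^ n) (loop_point c (\<lambda>t. \<alpha> t @ []) (\<lambda>t. [] @ \<beta> t)) =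
      prepend T \<beta> (prepend T (\<lambda>_. []) (loop_point c (\<lambda>t. \<alpha> t @ []) (\<lambda>t. [] @ \<beta> t)))"
    by (rule loop_point_transit[where S = S and m = n, OF refl _ transit_0])
      (use assms in \<open>simp_all add: loop_def\<close>)
  then show ?thesis
    using prepend_loop_point[OF assms(1)] loop_point_in[OF assms] by (simp add: prepend_empty)
qed

section \<open>Orbits of loop points and their closure\<close>

lemma loop_orbits_in: "c \<in> X \<Longrightarrow> loop_orbits c S \<subseteq> X"
  using loop_point_in funpow_f_in unfolding loop_orbits_def by blast

lemma f_loop_orbits: "p \<in> loop_orbits c S \<Longrightarrow> f p \<in> loop_orbits c S"
  unfolding loop_orbits_def by (smt (verit, best) funpow.simps(2) comp_apply mem_Collect_eq)

lemma funpow_f_loop_orbits: "p \<in> loop_orbits c S \<Longrightarrow> (f ^^ m) p \<in> loop_orbits c S"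
  by (induction m) (auto simp: f_loop_orbits)

lemma loop_orbits_periodic:
  assumes "c \<in> X" "p \<in> loop_orbits c S"
  shows "\<exists>n>0. (f ^^ n) p = p"
proof -
  obtain k n \<alpha> \<beta> where p: "p = (f ^^ k) (loop_point c \<alpha> \<beta>)" and l: "loop (heads T c) S n \<alpha> \<beta>"
    using assms(2) unfolding loop_orbits_def by blast
  have "(f ^^ n) p = (f ^^ k) ((f ^^ n) (loop_point c \<alpha> \<beta>))"
    unfolding p by (metis add.commute comp_apply funpow_add)
  then have "(f ^^ n) p = p"
    using loop_point_periodic[OF l assms(1)] p by simp
  then show ?thesis using l by (auto simp: loop_def)
qed

text \<open>Each further copy of the given loop adds at least one letter on every tape of
  \<open>S\<close>. Invariance of \<open>p\<close> under the longer words says that they are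
  prefixes of the point of the original loop.\<close>

lemma loop_power:
  fixes c :: "'t \<Rightarrow> nat \<Rightarrow> 'a"
  assumes l: "loop q S n \<alpha> \<beta>"
  defines "p \<equiv> loop_point c \<alpha> \<beta>"
  shows "\<exists>m \<alpha>' \<beta>'. Suc a \<le> m \<and> loop q S m \<alpha>' \<beta>' \<and> (\<forall>t\<in>S. t \<in> T \<longrightarrow> Suc a \<le> length (\<alpha>' t @ \<beta>' t)) \<and>
    prepend T \<alpha>' p = p \<and> prepend T \<beta>' p = p"
proof (induction a)
  case 0
  show ?case
    using l prepend_loop_point[OF l, of c] unfolding p_def
    by (intro exI[of _ n] exI[of _ \<alpha>] exI[of _ \<beta>]) (auto simp: loop_def Suc_le_eq)
next
  case (Suc a)
  then obtain m \<alpha>' \<beta>' where IH: "Suc a \<le> m" "loop q S m \<alpha>' \<beta>'"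
    "\<And>t. t \<in> S \<Longrightarrow> t \<in> T \<Longrightarrow> Suc a \<le> length (\<alpha>' t @ \<beta>' t)"
    "prepend T \<alpha>' p = p" "prepend T \<beta>' p = p"
    by blast
  have "Suc (Suc a) \<le> length ((\<alpha> t @ \<alpha>' t) @ (\<beta>' t @ \<beta> t))" if "t \<in> S" "t \<in> T" for t
  proof -
    have "\<alpha> t @ \<beta> t \<noteq> []" using l that by (simp add: loop_def)
    then have "length (\<alpha> t @ \<beta> t) > 0" by (simp only: length_greater_0_conv not_False_eq_True)
    then show ?thesis using IH(3)[OF that] unfolding length_append by linarith
  qed
  moreover have "prepend T (\<lambda>t. \<alpha> t @ \<alpha>' t) p = p" "prepend T (\<lambda>t. \<beta>' t @ \<beta> t) p = p"
    using prepend_loop_point[OF l, of c] IH(4,5) by (simp_all add: p_def flip: prepend_prepend)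
  moreover have "Suc (Suc a) \<le> n + m" using IH(1) l by (simp add: loop_def)
  ultimately show ?case using loop_trans[OF l IH(2)] by blast
qed

lemma conc_agree: "i < length w \<Longrightarrow> (w \<frown> s) i = (w \<frown> s') i"
  by simp

text \<open>After the first run each tape of \<open>p\<close> carries the word just written or the
  word still to be read. Where this word shares \<open>a\<close> letters with \<open>u\<close> the
  tapes agree up to \<open>a\<close>; tapes outside \<open>S\<close> are copied from
  \<open>c\<close>.\<close>

lemma loop_point_shadow:
  assumes u: "u \<in> X" and c: "c \<in> X" "heads T c = q"
    and 1: "transit q n \<alpha> \<beta> q'" and 2: "transit q' n' \<alpha>' \<beta>' q"
    and l: "loop q S m (\<lambda>t. \<alpha> t @ \<alpha>' t) (\<lambda>t. \<beta>' t @ \<beta> t)"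
    and active: "\<And>t. t \<in> T \<Longrightarrow> t \<in> S \<Longrightarrow>
      \<exists>w s s'. a \<le> length w \<and> \<beta> t @ \<alpha>' t = w @ s \<and> u t = w \<frown> s'"
    and inactive: "\<And>t. t \<in> T \<Longrightarrow> t \<notin> S \<Longrightarrow> u t = c t"
  shows "(f ^^ n) (loop_point c (\<lambda>t. \<alpha> t @ \<alpha>' t) (\<lambda>t. \<beta>' t @ \<beta> t)) \<in> cylinder T A a u"
proof -
  define p where "p = loop_point c (\<lambda>t. \<alpha> t @ \<alpha>' t) (\<lambda>t. \<beta>' t @ \<beta> t)"
  have eq: "(f ^^ n) p t = (\<beta> t @ \<alpha>' t) \<frown> p t" if "t \<in> T" for t
    using loop_point_transit[OF c(2) 1 2 l] that by (simp add: p_def prepend_apply)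
  have "(f ^^ n) p t i = u t i" if t: "t \<in> T" "i < a" for t i
  proof (cases "t \<in> S")
    case True
    obtain w s s' where w: "a \<le> length w" "\<beta> t @ \<alpha>' t = w @ s" "u t = w \<frown> s'"
      using active[OF t(1) True] by blast
    have "(f ^^ n) p t i = (w \<frown> s \<frown> p t) i"
      unfolding eq[OF t(1)] w(2) by simp
    also have "\<dots> = u t i"
      unfolding w(3) using w(1) t(2) by (intro conc_agree) simp
    finally show ?thesis .
  next
    case False
    then have "\<alpha> t = []" "\<beta> t = []" "\<alpha>' t = []" "\<beta>' t = []"
      using l t by (auto simp: loop_def)
    then show ?thesis
      using eq[OF t(1)] inactive[OF t(1) False] t by (simp add: p_def loop_point_def)
  qed
  moreover have "(f ^^ n) p \<in> X"
    unfolding p_def by (intro funpow_f_in loop_point_in[OF l c(1)])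
  ultimately show ?thesis by (simp add: cylinder_def p_def)
qed

text \<open>The point of the loop \<open>w w w' w'\<close>, for high powers \<open>w\<close>, \<open>w'\<close> of two given loops, shadows
  both their points: doubling provides the right past (on the output tapes) and the right future
  (on the input tapes) simultaneously.\<close>

lemma loop_orbits_transitive:
  assumes c: "c \<in> X" and p: "p \<in> loop_orbits c S" and p': "p' \<in> loop_orbits c S"
  shows "\<exists>r\<in>loop_orbits c S. \<exists>j>0. r \<in> cylinder T A a p \<and> (f ^^ j) r \<in> cylinder T A a p'"
proof -
  define q where "q = heads T c"
  obtain k n \<alpha> \<beta> where l: "loop q S n \<alpha> \<beta>" and p: "p = (f ^^ k) (loop_point c \<alpha> \<beta>)"
    using p unfolding loop_orbits_def q_def by blast
  obtain k' n' \<alpha>' \<beta>' where l': "loop q S n' \<alpha>' \<beta>'" and p': "p' = (f ^^ k') (loop_point c \<alpha>' \<beta>')"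
    using p' unfolding loop_orbits_def q_def by blast
  \<comment> \<open>Shadowing is arranged at \<open>P\<close> and \<open>P'\<close>; the extra
    letters are used up by the \<open>k\<close> and \<open>k'\<close> further steps to
    \<open>p\<close> and \<open>p'\<close>.\<close>
  define b where "b = a + k + k'"
  define P where "P = loop_point c \<alpha> \<beta>"
  define P' where "P' = loop_point c \<alpha>' \<beta>'"
  obtain m x y where xy: "Suc b \<le> m" "loop q S m x y"
      "\<And>t. t \<in> S \<Longrightarrow> t \<in> T \<Longrightarrow> Suc b \<le> length (x t @ y t)"
      "prepend T x P = P" "prepend T y P = P"
    using loop_power[OF l, of b c] unfolding P_def by blast
  obtain m' x' y' where xy': "Suc b \<le> m'" "loop q S m' x' y'"
      "\<And>t. t \<in> S \<Longrightarrow> t \<in> T \<Longrightarrow> Suc b \<le> length (x' t @ y' t)"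
      "prepend T x' P' = P'" "prepend T y' P' = P'"
    using loop_power[OF l', of b c] unfolding P'_def by blast
  define X4 where "X4 = (\<lambda>t. x t @ x t @ x' t @ x' t)"
  define Y4 where "Y4 = (\<lambda>t. y' t @ y' t @ y t @ y t)"
  have tail: "loop q S (m + (m' + m')) (\<lambda>t. x t @ x' t @ x' t) (\<lambda>t. (y' t @ y' t) @ y t)"
    using loop_trans[OF xy(2) loop_trans[OF xy'(2) xy'(2)]] by simp
  have whole: "loop q S (m + (m + (m' + m'))) X4 Y4"
    using loop_trans[OF xy(2) tail] by (simp add: X4_def Y4_def)
  have init: "loop q S (m + (m + m')) (\<lambda>t. x t @ x t @ x' t) (\<lambda>t. (y' t @ y t) @ y t)"
    using loop_trans[OF xy(2) loop_trans[OF xy(2) xy'(2)]] by simp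
  define R where "R = loop_point c X4 Y4"
  have inX: "P \<in> X" "P' \<in> X" "R \<in> X"
    unfolding P_def P'_def R_def using loop_point_in l l' whole c by blast+
  have words: "x t = [] \<or> y t = []" "x' t = [] \<or> y' t = []" "x t = [] \<or> y' t = []" "x' t = [] \<or> y t = []"
    if "t \<in> T" for t
    using xy(2) xy'(2) that transit_input transit_output unfolding loop_def by metis+
  \<comment> \<open>The loop is cut after its first quarter: one copy of \<open>w\<close> has been
    traversed and another lies ahead.\<close>
  have "(f ^^ m) (loop_point c (\<lambda>t. x t @ x t @ x' t @ x' t) (\<lambda>t. (y' t @ y' t @ y t) @ y t))
      \<in> cylinder T A (Suc b) P"
  proof (rule loop_point_shadow[where q = q and q' = q and n' = "m + (m' + m')" and S = S
        and m = "m + (m + (m' + m'))" and \<alpha>' = "\<lambda>t. x t @ x' t @ x' t" and \<beta>' = "\<lambda>t. y' t @ y' t @ y t"])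
    show "P t = c t" if "t \<in> T" "t \<notin> S" for t
      using l that by (auto simp: P_def loop_point_def loop_def)
    show "\<exists>w s s'. Suc b \<le> length w \<and> y t @ x t @ x' t @ x' t = w @ s \<and> P t = w \<frown> s'"
      if t: "t \<in> T" "t \<in> S" for t
    proof (rule exI[of _ "y t @ x t"], rule exI[of _ "x' t @ x' t"], rule exI[of _ "P t"], intro conjI)
      show "Suc b \<le> length (y t @ x t)" using xy(3)[OF t(2,1)] by simp
      show "P t = (y t @ x t) \<frown> P t"
        using xy(4,5) t by (metis conc_conc prepend_apply)
    qed simp
  qed (use c xy(2) tail whole inX in \<open>simp_all add: loop_def q_def X4_def Y4_def\<close>)
  then have A: "(f ^^ m) R \<in> cylinder T A (Suc b) P"
    by (simp add: R_def X4_def Y4_def)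
  \<comment> \<open>The second cut lies between the two copies of \<open>w'\<close>.\<close>
  have "(f ^^ (m + (m + m'))) (loop_point c (\<lambda>t. (x t @ x t @ x' t) @ x' t) (\<lambda>t. y' t @ y' t @ y t @ y t))
      \<in> cylinder T A (Suc b) P'"
  proof (rule loop_point_shadow[where q = q and q' = q and n' = m' and S = S
        and m = "m + (m + (m' + m'))" and \<alpha> = "\<lambda>t. x t @ x t @ x' t" and \<beta> = "\<lambda>t. y' t @ y t @ y t"])
    show "P' t = c t" if "t \<in> T" "t \<notin> S" for t
      using l' that by (auto simp: P'_def loop_point_def loop_def)
    show "\<exists>w s s'. Suc b \<le> length w \<and> (y' t @ y t @ y t) @ x' t = w @ s \<and> P' t = w \<frown> s'"
      if t: "t \<in> T" "t \<in> S" for t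
    proof (rule exI[of _ "y' t @ x' t"], rule exI[of _ "y t @ y t"], rule exI[of _ "P' t"], intro conjI)
      show "Suc b \<le> length (y' t @ x' t)" using xy'(3)[OF t(2,1)] by simp
      show "P' t = (y' t @ x' t) \<frown> P' t"
        using xy'(4,5) t by (metis conc_conc prepend_apply)
      \<comment> \<open>On output tapes \<open>x'\<close> is empty, and on input tapes
        \<open>y\<close> and \<open>y'\<close> are, so moving \<open>x' t\<close> forward changes
        nothing.\<close>
      show "(y' t @ y t @ y t) @ x' t = (y' t @ x' t) @ y t @ y t"
        using words[OF t(1)] by auto
    qed
  qed (use c xy'(2) init whole inX in \<open>simp_all add: loop_def q_def X4_def Y4_def\<close>)
  then have B: "(f ^^ (m + (m + m'))) R \<in> cylinder T A (Suc b) P'"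
    by (simp add: R_def X4_def Y4_def)
  \<comment> \<open>The time between the visits near \<open>p\<close> and near \<open>p'\<close>. It
    is positive because \<open>m\<close> exceeds \<open>b\<close> and hence
    \<open>k\<close>.\<close>
  define j where "j = m + m + m' + k' - (m + k)"
  have j: "j > 0" "j + (k + m) = k' + (m + (m + m'))"
    using xy(1) by (auto simp: j_def b_def)
  have "(f ^^ (k + m)) R \<in> loop_orbits c S"
    unfolding R_def loop_orbits_def using whole q_def by blast
  moreover have "(f ^^ (k + m)) R \<in> cylinder T A a p"
  proof -
    have "(f ^^ m) R \<in> cylinder T A (a + k) P"
      using A cylinder_mono[of "a + k" "Suc b"] by (auto simp: b_def)
    then show ?thesis
      using funpow_f_cylinder[OF inX(1)] unfolding p P_def by (simp add: funpow_add)
  qed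
  moreover have "(f ^^ j) ((f ^^ (k + m)) R) \<in> cylinder T A a p'"
  proof -
    have "(f ^^ (m + (m + m'))) R \<in> cylinder T A (a + k') P'"
      using B cylinder_mono[of "a + k'" "Suc b"] by (auto simp: b_def)
    then have "(f ^^ (k' + (m + (m + m')))) R \<in> cylinder T A a p'"
      using funpow_f_cylinder[OF inX(2)] unfolding p' P'_def by (simp add: funpow_add)
    then show ?thesis unfolding j(2)[symmetric] by (simp add: funpow_add)
  qed
  ultimately show ?thesis using j(1) by blast
qed

text \<open>Loop orbits consist of periodic points, are invariant, and are dense in their closure.
  By density, transitivity has to be checked only for cylinders around their points.\<close>

lemma chaotic_loop_closure:
  assumes c: "c \<in> X"
  shows "chaotic (submetric (config_metric T A) (top closure_of loop_orbits c S)) f"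
proof -
  define P where "P = loop_orbits c S"
  define Z where "Z = top closure_of P"
  have P: "P \<subseteq> X" using loop_orbits_in[OF c] by (simp add: P_def)
  have Z: "Z = {u \<in> X. \<forall>n. \<exists>v\<in>P. v \<in> cylinder T A n u}"
    by (simp add: Z_def closure_of_config)
  have PZ: "P \<subseteq> Z"
    unfolding Z_def using P topspace_config[OF finite_tapes, of A] by (metis closure_of_subset)
  have ms: "mspace (submetric (config_metric T A) Z) = Z"
    using Z by (auto simp: mspace_config_metric)
  have mt: "mtopology_of (submetric (config_metric T A) Z) = subtopology top Z"
    by (rule mtopology_of_submetric)
  have inv: "f u \<in> Z" if u: "u \<in> Z" for u
    unfolding Z
  proof (intro CollectI conjI allI)
    show "f u \<in> X" using u Z f_in by blast
    fix n
    obtain v where "v \<in> P" "v \<in> cylinder T A (Suc n) u" using u Z by blast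
    then show "\<exists>v\<in>P. v \<in> cylinder T A n (f u)"
      using f_cylinder f_loop_orbits u Z unfolding P_def by blast
  qed
  have "compactin top Z"
    using dynamical_system_automaton unfolding dynamical_system_def Z_def
    by (intro closedin_compact_space) auto
  then have "compact_space (subtopology top Z)"
    by (rule compact_space_subtopology)
  moreover have "continuous_map (subtopology top Z) (subtopology top Z) f"
    using inv continuous_map_from_subtopology[OF continuous_f]
    by (auto simp: continuous_map_in_subtopology)
  ultimately have "dynamical_system (submetric (config_metric T A) Z) f"
    by (simp add: dynamical_system_def mt)
  moreover have "subtopology top Z closure_of {u \<in> Z. periodic_point f u} = Z"
  proof
    show "subtopology top Z closure_of {u \<in> Z. periodic_point f u} \<subseteq> Z"
      using closure_of_subset_topspace[of "subtopology top Z"] by fastforce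
    have "P \<subseteq> Z \<inter> {u \<in> Z. periodic_point f u}"
      using PZ loop_orbits_periodic[OF c] by (auto simp: P_def periodic_point_def)
    then have "Z \<subseteq> top closure_of (Z \<inter> {u \<in> Z. periodic_point f u})"
      unfolding Z_def by (rule closure_of_mono)
    then show "Z \<subseteq> subtopology top Z closure_of {u \<in> Z. periodic_point f u}"
      unfolding closure_of_subtopology by blast
  qed
  moreover have "\<exists>k>0. (f ^^ k) ` U \<inter> V \<noteq> {}"
    if U: "openin (subtopology top Z) U" "U \<noteq> {}" and V: "openin (subtopology top Z) V" "V \<noteq> {}" for U V
  proof -
    \<comment> \<open>By density the cylinder around \<open>u\<close> contains a point of
      \<open>P\<close>, and by \<open>cylinder_eq\<close> it is also the cylinder around that
      point.\<close>
    have nbh: "\<exists>p\<in>P. \<exists>n. cylinder T A n p \<inter> Z \<subseteq> W"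
      if W: "openin (subtopology top Z) W" "W \<noteq> {}" for W
    proof -
      obtain W' where W': "openin top W'" "W = W' \<inter> Z"
        using W(1) unfolding openin_subtopology by blast
      obtain u where u: "u \<in> W'" "u \<in> Z" using W W' by blast
      then obtain n where n: "cylinder T A n u \<subseteq> W'"
        using W'(1) unfolding openin_config[OF finite_tapes] by blast
      obtain p where "p \<in> P" "p \<in> cylinder T A n u" using u Z by blast
      then show ?thesis using n cylinder_eq W' by blast
    qed
    obtain p m where p: "p \<in> P" "cylinder T A m p \<inter> Z \<subseteq> U" using nbh[OF U] by blast
    obtain p' m' where p': "p' \<in> P" "cylinder T A m' p' \<inter> Z \<subseteq> V" using nbh[OF V] by blast
    obtain r j where r: "r \<in> P" "j > 0" "r \<in> cylinder T A (max m m') p"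
        "(f ^^ j) r \<in> cylinder T A (max m m') p'"
      using loop_orbits_transitive[OF c p(1)[unfolded P_def] p'(1)[unfolded P_def]]
      unfolding P_def by blast
    have "r \<in> U"
      using r(1,3) p(2) PZ cylinder_mono[of m "max m m'" T A p] by auto
    moreover have "(f ^^ j) r \<in> V"
      using r(4) p'(2) PZ cylinder_mono[of m' "max m m'" T A p'] funpow_f_loop_orbits[OF r(1)[unfolded P_def], of j]
      by (auto simp: P_def)
    ultimately show ?thesis using r(2) by blast
  qed
  ultimately show ?thesis
    unfolding chaotic_def P_def[symmetric] Z_def[symmetric] ms mt by blast
qed

section \<open>Shadowing an orbit by loops\<close>

lemma eventually_card_ge:
  assumes "infinite (M :: nat set)"
  shows "eventually (\<lambda>n. a \<le> card (M \<inter> {..<n})) sequentially"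
proof -
  obtain F where F: "F \<subseteq> M" "finite F" "card F = a"
    using infinite_arbitrarily_large[OF assms] by blast
  then obtain N where "\<forall>k\<in>F. k < N"
    using finite_nat_set_iff_bounded by blast
  then have "a \<le> card (M \<inter> {..<n})" if "n \<ge> N" for n
    using F that by (metis Int_subset_iff card_mono finite_Int finite_lessThan lessThan_iff
        order_less_le_trans subsetI)
  then show ?thesis unfolding eventually_sequentially by blast
qed

lemma eventually_card_moves:
  assumes "\<And>t. t \<in> T \<Longrightarrow> t \<in> S \<Longrightarrow> infinite (moves u t)"
  shows "\<exists>N. \<forall>n\<ge>N. \<forall>t\<in>T \<inter> S. a \<le> card (moves u t \<inter> {..<n})"
proof -
  have "eventually (\<lambda>n. \<forall>t\<in>T \<inter> S. a \<le> card (moves u t \<inter> {..<n})) sequentially"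
    using assms by (intro eventually_ball_finite ballI eventually_card_ge) auto
  then show ?thesis unfolding eventually_sequentially .
qed

text \<open>The orbit from \<open>c\<close> to time \<open>m\<close>, continued until the state of
  \<open>c\<close> recurs, is a loop. Its past supplies the output tapes at time \<open>m\<close>,
  its future the input tapes.\<close>

lemma orbit_near_loop_orbits:
  assumes c: "c \<in> X" and rec: "infinite {m. heads T ((f ^^ m) c) = heads T c}"
    and active: "\<And>t. t \<in> T \<Longrightarrow> t \<in> S \<Longrightarrow> infinite (moves c t)"
    and inactive: "\<And>t. t \<in> T \<Longrightarrow> t \<notin> S \<Longrightarrow> moves c t = {}"
  shows "\<exists>N. \<forall>m\<ge>N. \<exists>p\<in>loop_orbits c S. p \<in> cylinder T A a ((f ^^ m) c)"
proof -
  \<comment> \<open>Asking for \<open>Suc a\<close> letters keeps the words nonempty on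
    \<open>S\<close> even when \<open>a\<close> is 0, as \<open>loop\<close> requires.\<close>
  obtain N where N: "\<And>n t. n \<ge> N \<Longrightarrow> t \<in> T \<inter> S \<Longrightarrow> Suc a \<le> card (moves c t \<inter> {..<n})"
    using eventually_card_moves[OF active] by metis
  have "\<exists>p\<in>loop_orbits c S. p \<in> cylinder T A a ((f ^^ m) c)" if m: "m \<ge> N" for m
  proof -
    define u where "u = (f ^^ m) c"
    have u: "u \<in> X" using c by (simp add: u_def funpow_f_in)
    have "infinite (moves u t)" if "t \<in> T" "t \<in> S" for t
    proof
      assume "finite (moves u t)"
      then have "finite ((\<lambda>k. k + m) ` moves u t \<union> {..<m})" by simp
      moreover have "moves c t \<subseteq> (\<lambda>k. k + m) ` moves u t \<union> {..<m}"
      proof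
        fix k
        assume k: "k \<in> moves c t"
        show "k \<in> (\<lambda>k. k + m) ` moves u t \<union> {..<m}"
        proof (cases "k < m")
          case False
          then have "k - m \<in> moves u t" "k = (k - m) + m"
            using k by (auto simp: u_def moves_funpow)
          then show ?thesis by blast
        qed simp
      qed
      ultimately show False using active[OF that] finite_subset by blast
    qed
    then obtain N' where N': "\<And>n t. n \<ge> N' \<Longrightarrow> t \<in> T \<inter> S \<Longrightarrow> Suc a \<le> card (moves u t \<inter> {..<n})"
      using eventually_card_moves[of S u] by metis
    \<comment> \<open>A return to the initial state, late enough after \<open>m\<close> for every
      tape in \<open>S\<close> to have moved more than \<open>a\<close> times since.\<close>
    obtain k where k: "k > N' + m" "heads T ((f ^^ k) c) = heads T c"
      using rec unfolding infinite_nat_iff_unbounded by blast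
    define n where "n = k - m"
    have n: "n > 0" "n \<ge> N'" "n + m = k"
      using k by (auto simp: n_def)
    have hn: "heads T ((f ^^ n) u) = heads T c"
      using k(2) n(3) by (metis comp_apply funpow_add u_def)
    have none: "reads c m t = []" "writes c m t = []" "reads u n t = []" "writes u n t = []"
      if "t \<in> T" "t \<notin> S" for t
    proof -
      have "moves u t = {}" using inactive[OF that] by (simp add: u_def moves_funpow)
      then show "reads c m t = []" "writes c m t = []" "reads u n t = []" "writes u n t = []"
        using length_words[of c m t] length_words[of u n t] inactive[OF that] by simp_all
    qed
    have long: "Suc a \<le> length (reads c m t) + length (writes c m t)"
      "Suc a \<le> length (reads u n t) + length (writes u n t)" if "t \<in> T" "t \<in> S" for t
      using N[OF m, of t] N'[OF n(2), of t] that unfolding length_words by auto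
    have 1: "transit (heads T c) m (reads c m) (writes c m) (heads T u)"
      using transit_orbit[OF c, of m] by (simp add: u_def)
    have 2: "transit (heads T u) n (reads u n) (writes u n) (heads T c)"
      using transit_orbit[OF u, of n] by (simp add: hn)
    have "(reads c m t @ reads u n t) @ writes u n t @ writes c m t \<noteq> [] \<longleftrightarrow> t \<in> S" if "t \<in> T" for t
      using none[of t] long[of t] that by (cases "t \<in> S") auto
    then have l: "loop (heads T c) S (m + n) (\<lambda>t. reads c m t @ reads u n t) (\<lambda>t. writes u n t @ writes c m t)"
      unfolding loop_def using transit_trans[OF 1 2] n(1) by blast
    have "(f ^^ m) (loop_point c (\<lambda>t. reads c m t @ reads u n t) (\<lambda>t. writes u n t @ writes c m t))
        \<in> cylinder T A a u"
    proof (rule loop_point_shadow[OF u c refl 1 2 l])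
      fix t
      assume t: "t \<in> T" "t \<in> S"
      show "\<exists>w s s'. a \<le> length w \<and> writes c m t @ reads u n t = w @ s \<and> u t = w \<frown> s'"
      proof (cases "t \<in> inputs")
        case True
        then have "writes c m t = []" "writes u n t = []"
          using transit_input[OF 1] transit_input[OF 2] by auto
        then show ?thesis
          using input_orbit[OF u True, of n] long(2)[OF t]
          by (intro exI[of _ "reads u n t"] exI[of _ "[]"] exI[of _ "(f ^^ n) u t"]) auto
      next
        case False
        then have "reads c m t = []" "reads u n t = []"
          using transit_output[OF 1 t(1)] transit_output[OF 2 t(1)] by auto
        then show ?thesis
          using output_orbit[OF c t(1) False, of m] long(1)[OF t]
          by (intro exI[of _ "writes c m t"] exI[of _ "[]"] exI[of _ "c t"]) (auto simp: u_def)
      qed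
    next
      fix t
      assume t: "t \<in> T" "t \<notin> S"
      show "u t = c t"
        using input_orbit[OF c, of t m] output_orbit[OF c, of t m] none[OF t] t
        by (cases "t \<in> inputs") (auto simp: u_def)
    qed
    then show ?thesis
      using l unfolding loop_orbits_def u_def by blast
  qed
  then show ?thesis by blast
qed

text \<open>Late points of the orbit of \<open>x\<close> are close to loop orbits, which are
  invariant, so nothing new enters the limit. Conversely, periodic points recur at arbitrarily late
  times.\<close>

lemma omega_limit_loop_orbits:
  assumes c: "c \<in> X" and x: "x \<in> X" "c = (f ^^ i) x"
    and near: "\<And>a. \<exists>N. \<forall>m\<ge>N. \<exists>p\<in>loop_orbits c S. p \<in> cylinder T A a ((f ^^ m) c)"
  shows "omega_limit (config_metric T A) f (insert x (loop_orbits c S)) = top closure_of loop_orbits c S"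
proof
  define P where "P = loop_orbits c S"
  have cl: "u \<in> top closure_of B \<longleftrightarrow> u \<in> X \<and> (\<forall>n. \<exists>v\<in>B. v \<in> cylinder T A n u)" for B u
    by (simp add: closure_of_config)
  show "omega_limit (config_metric T A) f (insert x P) \<subseteq> top closure_of P"
  proof
    fix z
    assume "z \<in> omega_limit (config_metric T A) f (insert x P)"
    then have z: "z \<in> top closure_of (\<Union>m\<in>{n<..}. (f ^^ m) ` insert x P)" for n
      by (simp add: omega_limit_def)
    have "\<exists>p\<in>P. p \<in> cylinder T A a z" for a
    proof -
      obtain N where N: "\<And>m. m \<ge> N \<Longrightarrow> \<exists>p\<in>P. p \<in> cylinder T A a ((f ^^ m) c)"
        using near[of a] unfolding P_def by blast
      \<comment> \<open>The first \<open>i\<close> steps only lead from \<open>x\<close> to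
        \<open>c\<close>; more than \<open>N\<close> steps from \<open>c\<close> remain.\<close>
      obtain m y where m: "m > N + i" "y \<in> insert x P" "(f ^^ m) y \<in> cylinder T A a z"
        using z[of "N + i"] unfolding cl by blast
      show ?thesis
      proof (cases "y \<in> P")
        case True
        then show ?thesis using m(3) funpow_f_loop_orbits unfolding P_def by blast
      next
        case False
        then have "(f ^^ m) y = (f ^^ (m - i)) c"
          using m(1,2) x(2) funpow_add[of "m - i" i f] by simp
        moreover have "m - i \<ge> N" using m(1) by simp
        ultimately show ?thesis
          using N[of "m - i"] cylinder_eq[OF m(3)] by simp
      qed
    qed
    then show "z \<in> top closure_of P"
      using z[of 0] unfolding cl by blast
  qed
  have "p \<in> (\<Union>m\<in>{n<..}. (f ^^ m) ` insert x P)" if p: "p \<in> P" for p n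
  proof -
    obtain k where k: "k > 0" "(f ^^ k) p = p"
      using loop_orbits_periodic[OF c p[unfolded P_def]] by blast
    \<comment> \<open>Repeating the period \<open>Suc n\<close> times postpones the return beyond
      time \<open>n\<close>.\<close>
    have "((f ^^ k) ^^ Suc n) p = p"
      by (induction n) (simp_all add: k(2))
    then have "(f ^^ (k * Suc n)) p = p"
      by (simp only: funpow_mult mult.commute)
    moreover have "n < k * Suc n" using k(1) by (cases k) auto
    ultimately show ?thesis
      using p by (metis UN_iff greaterThan_iff imageI insertI2)
  qed
  then show "top closure_of P \<subseteq> omega_limit (config_metric T A) f (insert x P)"
    unfolding omega_limit_def by (intro INT_greatest closure_of_mono subsetI)
qed

text \<open>There are finitely many states, so some state occurs infinitely often, and it occurs in
  particular after the finitely many moves of the tapes outside \<open>S\<close>.\<close>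

lemma recurrent_configuration:
  assumes x: "x \<in> X"
  defines "S \<equiv> {t \<in> T. infinite (moves x t)}"
  shows "\<exists>i. infinite {m. heads T ((f ^^ m) ((f ^^ i) x)) = heads T ((f ^^ i) x)} \<and>
    (\<forall>t\<in>T. if t \<in> S then infinite (moves ((f ^^ i) x) t) else moves ((f ^^ i) x) t = {})"
proof -
  \<comment> \<open>Dropping the first \<open>i\<close> times keeps an infinite set of times
    infinite; this serves both the recurring state and the moves.\<close>
  have shift: "infinite {k. k + i \<in> M}" if "infinite M" for i and M :: "nat set"
  proof
    assume "finite {k. k + i \<in> M}"
    then have "finite ((\<lambda>k. k + i) ` {k. k + i \<in> M} \<union> {..<i})" by simp
    moreover have "M \<subseteq> (\<lambda>k. k + i) ` {k. k + i \<in> M} \<union> {..<i}"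
    proof
      fix k
      assume "k \<in> M"
      then show "k \<in> (\<lambda>k. k + i) ` {k. k + i \<in> M} \<union> {..<i}"
        by (cases "k < i") (auto simp: image_iff intro!: exI[of _ "k - i"])
    qed
    ultimately show False using that finite_subset by blast
  qed
  have "finite ((\<lambda>m. heads T ((f ^^ m) x)) ` UNIV)"
    using finite_states heads_in funpow_f_in[OF x] by (auto intro: finite_subset)
  then obtain m0 where m0: "infinite {m \<in> UNIV. heads T ((f ^^ m) x) = heads T ((f ^^ m0) x)}"
    using pigeonhole_infinite infinite_UNIV_nat by blast
  have "finite (\<Union>t\<in>T - S. moves x t)"
    by (auto simp: S_def)
  then obtain N where N: "\<forall>k\<in>(\<Union>t\<in>T - S. moves x t). k < N"
    using finite_nat_set_iff_bounded by blast
  obtain i where i: "i > N" "heads T ((f ^^ i) x) = heads T ((f ^^ m0) x)"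
    using m0 unfolding infinite_nat_iff_unbounded by blast
  have "infinite {k. k + i \<in> {m. heads T ((f ^^ m) x) = heads T ((f ^^ i) x)}}"
    using m0 i(2) by (intro shift) simp
  then have "infinite {m. heads T ((f ^^ m) ((f ^^ i) x)) = heads T ((f ^^ i) x)}"
    by (simp add: funpow_add)
  moreover have "if t \<in> S then infinite (moves ((f ^^ i) x) t) else moves ((f ^^ i) x) t = {}"
    if "t \<in> T" for t
  proof (cases "t \<in> S")
    case True
    then show ?thesis using shift[of "moves x t" i] by (simp add: S_def moves_funpow)
  next
    case False
    have "k + i \<notin> moves x t" for k
      using N i(1) that False by (metis DiffI UN_I add.commute not_add_less1 order_less_trans)
    then show ?thesis using False by (simp add: moves_funpow)
  qed
  ultimately show ?thesis by blast
qed

lemma has_chaotic_limits_automaton: "has_chaotic_limits (config_metric T A) f"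
  unfolding has_chaotic_limits_def mspace_config_metric[OF finite_tapes]
proof (intro conjI ballI dynamical_system_automaton)
  fix x
  assume x: "x \<in> X"
  define S where "S = {t \<in> T. infinite (moves x t)}"
  obtain i where i: "infinite {m. heads T ((f ^^ m) ((f ^^ i) x)) = heads T ((f ^^ i) x)}"
      "\<forall>t\<in>T. if t \<in> S then infinite (moves ((f ^^ i) x) t) else moves ((f ^^ i) x) t = {}"
    using recurrent_configuration[OF x] unfolding S_def by blast
  define c where "c = (f ^^ i) x"
  have c: "c \<in> X" using x by (simp add: c_def funpow_f_in)
  have near: "\<exists>N. \<forall>m\<ge>N. \<exists>p\<in>loop_orbits c S. p \<in> cylinder T A a ((f ^^ m) c)" for a
    using c i unfolding c_def by (intro orbit_near_loop_orbits) (auto split: if_splits)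
  have "chaotic (submetric (config_metric T A)
      (omega_limit (config_metric T A) f (insert x (loop_orbits c S)))) f"
    unfolding omega_limit_loop_orbits[OF c x c_def near] using c by (rule chaotic_loop_closure)
  then show "\<exists>B\<subseteq>X. x \<in> B \<and> chaotic (submetric (config_metric T A) (omega_limit (config_metric T A) f B)) f"
    using x loop_orbits_in[OF c] by (intro exI[of _ "insert x (loop_orbits c S)"]) auto
qed

end

theorem theorem1:
  fixes T :: "'t set" and A :: "'t \<Rightarrow> 'a set"
    and \<delta> :: "'t \<Rightarrow> ('t \<Rightarrow> 'a) \<Rightarrow> 'a move"
  assumes "finite_automaton T A \<delta>"
  shows "has_chaotic_limits (config_metric T A) (automaton_map T \<delta>)"
  using assms by (intro finite_automaton_system.has_chaotic_limits_automaton finite_automaton_system.intro)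

end
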